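(* Let $X=\bigcap_{n=0}^\infty X_n$, with Banach spaces $(X_n,\|\cdot\|_n)$, and $Y=\bigcap_{n=0}^\infty Y_n$, with Banach spaces $(Y_n,|\cdot|_n)$, be compactly graded spaces. Let $f:X\to Y$ be continuous, strongly Gâteaux differentiable (at every point of $X$), and such that $f(0)=0$. Assume that there are $c>0$ and $d\in\{0\}\cup\mathbb{N}$ such that for each $x\in X$ and each $v\in Y$ there exists $u\in X$ with $$f'(x)u=v\quad\text{and}\quad \|u\|_n\le c\,|v|_{n+d},\quad\forall n\ge 0.$$ Then for each $y\in Y$ there is $x\in X$ such that $$f(x)=y\quad\text{and}\quad \|x\|_n\le c\,|y|_{n+d},\quad\forall n\ge 0.$$
   Context: A space $X$ is called compactly graded if $X=\bigcap_{n=0}^\infty X_n$, where $(X_n,\|\cdot\|_n)$ are nested Banach spaces, $X_{n+1}\subset X_n$, and for every $n\ge 0$ the identity operator from $X_{n+1}$ into $X_n$ is compact. Such an $X$ is equipped with the norms $\|\cdot\|_n$, $n\ge 0$, and the translation-invariant metric $$\rho_X(x,y):=\max_{n\ge 0}\frac{2^{-n}\|x-y\|_n}{1+\|x-y\|_n}$$ (a complete metric on $X$). The metric $\rho_Y$ on $Y$ is defined in the same way from the norms $|\cdot|_n$. Continuity is with respect to these metrics. A function $f:X\to Y$ is strongly Gâteaux differentiable at $x\in X$ if there exists a bounded linear operator $f'(x):X\to Y$ such that $$\lim_{t\downarrow 0}\frac{\rho_Y\big(f(x+th)-f(x),\,t f'(x)(h)\big)}{t}=0,\quad\forall h\in X.$$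 *)

theory Defs
  imports "HOL-Analysis.Analysis"
begin

text \<open>
  The nested Banach spaces are linear subspaces of an arbitrary ambient real vector space,
  each with its own norm function. Values of a norm function off its carrier are irrelevant.
\<close>

definition norm_on :: "'a::real_vector set \<Rightarrow> ('a \<Rightarrow> real) \<Rightarrow> bool" where
  "norm_on V N \<longleftrightarrow> subspace V
     \<and> (\<forall>x\<in>V. 0 \<le> N x)
     \<and> (\<forall>x\<in>V. N x = 0 \<longleftrightarrow> x = 0)
     \<and> (\<forall>x\<in>V. \<forall>a. N (a *\<^sub>R x) = \<bar>a\<bar> * N x)
     \<and> (\<forall>x\<in>V. \<forall>y\<in>V. N (x + y) \<le> N x + N y)"

text \<open>
  The off-carrier value is needed because the locale \<^locale>\<open>Metric_space\<close> asks for symmetry and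
  nonnegativity on the whole type.
\<close>

definition norm_dist :: "'a::real_vector set \<Rightarrow> ('a \<Rightarrow> real) \<Rightarrow> 'a \<Rightarrow> 'a \<Rightarrow> real" where
  "norm_dist V N x y = (if x \<in> V \<and> y \<in> V then N (x - y) else 0)"

definition norm_topology :: "'a::real_vector set \<Rightarrow> ('a \<Rightarrow> real) \<Rightarrow> 'a topology" where
  "norm_topology V N = Metric_space.mtopology V (norm_dist V N)"

definition banach_on :: "'a::real_vector set \<Rightarrow> ('a \<Rightarrow> real) \<Rightarrow> bool" where
  "banach_on V N \<longleftrightarrow> norm_on V N \<and> Metric_space.mcomplete V (norm_dist V N)"

text \<open>
  The identity from \<open>(V, N)\<close> into \<open>(W, M)\<close> is a compact operator: the image of the closed unit
  ball of \<open>V\<close> is relatively compact in \<open>W\<close>.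
\<close>

definition compact_inclusion ::
  "'a::real_vector set \<Rightarrow> ('a \<Rightarrow> real) \<Rightarrow> 'a set \<Rightarrow> ('a \<Rightarrow> real) \<Rightarrow> bool" where
  "compact_inclusion V N W M \<longleftrightarrow> V \<subseteq> W
     \<and> compactin (norm_topology W M) (norm_topology W M closure_of {x \<in> V. N x \<le> 1})"

definition compactly_graded ::
  "(nat \<Rightarrow> 'a::real_vector set) \<Rightarrow> (nat \<Rightarrow> 'a \<Rightarrow> real) \<Rightarrow> bool" where
  "compactly_graded X N \<longleftrightarrow> (\<forall>n. banach_on (X n) (N n))
     \<and> (\<forall>n. compact_inclusion (X (Suc n)) (N (Suc n)) (X n) (N n))"

definition graded_carrier :: "(nat \<Rightarrow> 'a set) \<Rightarrow> 'a set" where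
  "graded_carrier X = (\<Inter>n. X n)"

text \<open>The supremum is a maximum, see \<open>graded_dist_attained\<close> below.\<close>

definition graded_dist ::
  "(nat \<Rightarrow> 'a::real_vector set) \<Rightarrow> (nat \<Rightarrow> 'a \<Rightarrow> real) \<Rightarrow> 'a \<Rightarrow> 'a \<Rightarrow> real" where
  "graded_dist X N x y =
     (SUP n. (1/2) ^ n * norm_dist (X n) (N n) x y / (1 + norm_dist (X n) (N n) x y))"

definition graded_topology ::
  "(nat \<Rightarrow> 'a::real_vector set) \<Rightarrow> (nat \<Rightarrow> 'a \<Rightarrow> real) \<Rightarrow> 'a topology" where
  "graded_topology X N = Metric_space.mtopology (graded_carrier X) (graded_dist X N)"

text \<open>
  Boundedness is in the sense of topological vector spaces: a set is bounded iff every norm of the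
  grading is bounded on it. (Every set has finite diameter for \<^const>\<open>graded_dist\<close>.)
\<close>

definition graded_bounded ::
  "(nat \<Rightarrow> 'a::real_vector set) \<Rightarrow> (nat \<Rightarrow> 'a \<Rightarrow> real) \<Rightarrow> 'a set \<Rightarrow> bool" where
  "graded_bounded X N B \<longleftrightarrow> B \<subseteq> graded_carrier X \<and> (\<forall>n. \<exists>K. \<forall>x\<in>B. N n x \<le> K)"

definition bounded_linear_graded ::
  "(nat \<Rightarrow> 'a::real_vector set) \<Rightarrow> (nat \<Rightarrow> 'a \<Rightarrow> real) \<Rightarrow>
   (nat \<Rightarrow> 'b::real_vector set) \<Rightarrow> (nat \<Rightarrow> 'b \<Rightarrow> real) \<Rightarrow> ('a \<Rightarrow> 'b) \<Rightarrow> bool" where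
  "bounded_linear_graded X N Y M A \<longleftrightarrow>
     A ` graded_carrier X \<subseteq> graded_carrier Y
     \<and> (\<forall>x\<in>graded_carrier X. \<forall>y\<in>graded_carrier X. A (x + y) = A x + A y)
     \<and> (\<forall>a. \<forall>x\<in>graded_carrier X. A (a *\<^sub>R x) = a *\<^sub>R A x)
     \<and> (\<forall>B. graded_bounded X N B \<longrightarrow> graded_bounded Y M (A ` B))"

definition has_strong_gateaux_derivative ::
  "(nat \<Rightarrow> 'a::real_vector set) \<Rightarrow> (nat \<Rightarrow> 'a \<Rightarrow> real) \<Rightarrow>
   (nat \<Rightarrow> 'b::real_vector set) \<Rightarrow> (nat \<Rightarrow> 'b \<Rightarrow> real) \<Rightarrow>
   ('a \<Rightarrow> 'b) \<Rightarrow> ('a \<Rightarrow> 'b) \<Rightarrow> 'a \<Rightarrow> bool" where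
  "has_strong_gateaux_derivative X N Y M f A x \<longleftrightarrow>
     bounded_linear_graded X N Y M A
     \<and> (\<forall>h\<in>graded_carrier X.
          ((\<lambda>t. graded_dist Y M (f (x + t *\<^sub>R h) - f x) (t *\<^sub>R A h) / t) \<longlongrightarrow> 0) (at_right 0))"

lemma norm_dist_nonneg: "norm_on V N \<Longrightarrow> 0 \<le> norm_dist V N x y"
  by (auto simp: norm_dist_def norm_on_def subspace_diff)

lemma norm_dist_commute:
  assumes "norm_on V N" shows "norm_dist V N x y = norm_dist V N y x"
proof (cases "x \<in> V \<and> y \<in> V")
  case True
  then have "N ((-1) *\<^sub>R (y - x)) = \<bar>-1\<bar> * N (y - x)"
    using assms unfolding norm_on_def by (metis subspace_diff)
  with True show ?thesis by (simp add: norm_dist_def)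
qed (auto simp: norm_dist_def)

lemma Metric_space_norm_dist:
  assumes "norm_on V N" shows "Metric_space V (norm_dist V N)"
proof
  fix x y z assume V: "x \<in> V" "y \<in> V" "z \<in> V"
  then have "N ((x - y) + (y - z)) \<le> N (x - y) + N (y - z)"
    using assms unfolding norm_on_def by (metis subspace_diff)
  with V show "norm_dist V N x z \<le> norm_dist V N x y + norm_dist V N y z"
    by (simp add: norm_dist_def)
next
  fix x y assume V: "x \<in> V" "y \<in> V"
  then have "x - y \<in> V" using assms by (simp add: norm_on_def subspace_diff)
  with V assms show "norm_dist V N x y = 0 \<longleftrightarrow> x = y"
    by (auto simp: norm_dist_def norm_on_def)
qed (use assms norm_dist_nonneg norm_dist_commute in auto)

lemma graded_dist_on_carrier:
  assumes "x \<in> graded_carrier X" "y \<in> graded_carrier X"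
  shows "graded_dist X N x y = (SUP n. (1/2) ^ n * N n (x - y) / (1 + N n (x - y)))"
  using assms by (simp add: graded_dist_def norm_dist_def graded_carrier_def)

lemma graded_dist_attained:
  assumes "compactly_graded X N"
  defines "T \<equiv> \<lambda>x y n. (1/2) ^ n * norm_dist (X n) (N n) x y / (1 + norm_dist (X n) (N n) x y)"
  shows "\<exists>n. graded_dist X N x y = T x y n \<and> (\<forall>m. T x y m \<le> T x y n)"
proof -
  have d: "0 \<le> norm_dist (X n) (N n) x y" for n
    using assms(1) by (simp add: compactly_graded_def banach_on_def norm_dist_nonneg)
  have nn: "0 \<le> T x y n" for n using d[of n] by (simp add: T_def)
  have ub: "T x y n \<le> (1/2) ^ n" for n
    using d[of n] by (simp add: T_def divide_simps)
  have "\<exists>n. \<forall>m. T x y m \<le> T x y n"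
  proof (cases "\<exists>k. T x y k > 0")
    case False
    then show ?thesis using nn by (metis linorder_not_less order_trans)
  next
    case True
    then obtain k where k: "T x y k > 0" by blast
    obtain L where L: "(1/2::real) ^ L < T x y k"
      using real_arch_pow_inv[OF k, of "1/2"] by auto
    have fin: "finite (T x y ` {..max k L})" by simp
    have ne: "T x y ` {..max k L} \<noteq> {}" by simp
    obtain n where n: "T x y n = Max (T x y ` {..max k L})"
      using Max_in[OF fin ne] by (metis imageE)
    have small: "T x y m \<le> T x y n" if "m \<le> max k L" for m
      unfolding n using fin that by (intro Max_ge) auto
    have "T x y m \<le> T x y n" if "\<not> m \<le> max k L" for m
    proof -
      have "T x y m \<le> (1/2) ^ m" by (rule ub)
      also have "\<dots> \<le> (1/2) ^ L" using that by (intro power_decreasing) auto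
      also have "\<dots> < T x y k" by (rule L)
      also have "\<dots> \<le> T x y n" by (rule small) simp
      finally show ?thesis by simp
    qed
    with small show ?thesis by blast
  qed
  then obtain n where n: "\<And>m. T x y m \<le> T x y n" by blast
  have "(SUP m. T x y m) = T x y n"
    by (rule cSup_eq_maximum) (use n in auto)
  then show ?thesis using n by (auto simp: graded_dist_def T_def)
qed

end

theory Submission
  imports Defs "HOL-Library.Diagonal_Subsequence"
begin

text \<open>
  Fix \<open>y\<close> and \<open>\<epsilon> > 0\<close>, and consider all \<open>s \<in> [0, 1]\<close> for which some \<open>x\<close> satisfies
  \<open>\<parallel>x\<parallel>\<^sub>n \<le> s c |y|\<^sub>n\<^sub>+\<^sub>d\<close> for every \<open>n\<close> and \<open>\<rho>\<^sub>Y(f x, s y) \<le> \<epsilon> s\<close>.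
  Order bounded sets are relatively compact by a diagonal argument, hence the supremum of these \<open>s\<close>
  is attained. It is \<open>1\<close>: if \<open>s < 1\<close> and \<open>f'(x) u = y\<close>, translation invariance of \<open>\<rho>\<^sub>Y\<close> shows that
  \<open>x + t u\<close> works for \<open>s + t\<close> when \<open>t > 0\<close> is small. Letting \<open>\<epsilon> \<rightarrow> 0\<close>, compactness gives a solution.
\<close>

section \<open>Norms on subspaces and compact inclusions\<close>

context
  fixes V :: "'a::real_vector set" and N :: "'a \<Rightarrow> real"
  assumes N: "norm_on V N"
begin

lemma norm_on_nonneg: "x \<in> V \<Longrightarrow> 0 \<le> N x"
  and norm_on_eq_0: "x \<in> V \<Longrightarrow> N x = 0 \<longleftrightarrow> x = 0"
  and norm_on_scaleR: "x \<in> V \<Longrightarrow> N (a *\<^sub>R x) = \<bar>a\<bar> * N x"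
  and norm_on_triangle: "x \<in> V \<Longrightarrow> y \<in> V \<Longrightarrow> N (x + y) \<le> N x + N y"
  and norm_on_subspace: "subspace V"
  using N unfolding norm_on_def by auto

lemma norm_on_zero: "N 0 = 0"
  using norm_on_eq_0[of 0] norm_on_subspace by (simp add: subspace_0)

text \<open>Reduces topological convergence to convergence of real numbers. Eventual membership in
  \<open>V\<close> is a separate condition because \<open>norm_dist\<close> takes the default value
  0 off \<open>V\<close>.\<close>

lemma limitin_norm_topology:
  "limitin (norm_topology V N) \<sigma> l F \<longleftrightarrow>
     l \<in> V \<and> (\<forall>\<^sub>F k in F. \<sigma> k \<in> V) \<and> ((\<lambda>k. N (\<sigma> k - l)) \<longlongrightarrow> 0) F"
proof -
  interpret Metric_space V "norm_dist V N" by (rule Metric_space_norm_dist[OF N])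
  have "((\<lambda>k. norm_dist V N (\<sigma> k) l) \<longlongrightarrow> 0) F \<longleftrightarrow> ((\<lambda>k. N (\<sigma> k - l)) \<longlongrightarrow> 0) F"
    if "l \<in> V" "\<forall>\<^sub>F k in F. \<sigma> k \<in> V"
    by (rule tendsto_cong, rule eventually_mono[OF that(2)]) (use that in \<open>simp add: norm_dist_def\<close>)
  then show ?thesis
    unfolding norm_topology_def limitin_metric_dist_null by blast
qed

end

text \<open>A compact set is metrically bounded, so \<open>M\<close> is bounded on the unit ball of
  \<open>V\<close>, which contains 0. Normalising a nonzero vector and using homogeneity gives the
  estimate on all of \<open>V\<close>.\<close>

lemma compact_inclusion_bounded:
  assumes V: "norm_on V N" and W: "norm_on W M" and "compact_inclusion V N W M"
  obtains C where "\<And>x. x \<in> V \<Longrightarrow> M x \<le> C * N x"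
proof -
  interpret W: Metric_space W "norm_dist W M" by (rule Metric_space_norm_dist[OF W])
  let ?U = "{x \<in> V. N x \<le> 1}"
  have "V \<subseteq> W" and co: "compactin W.mtopology (W.mtopology closure_of ?U)"
    using assms(3) by (auto simp: compact_inclusion_def norm_topology_def)
  then have "?U \<subseteq> W.mtopology closure_of ?U"
    by (intro closure_of_subset) auto
  with W.compactin_imp_mbounded[OF co] have "W.mbounded ?U"
    by (rule W.mbounded_subset)
  then obtain C where C: "\<And>x y. x \<in> ?U \<Longrightarrow> y \<in> ?U \<Longrightarrow> norm_dist W M x y \<le> C"
    unfolding W.mbounded_alt by blast
  have "M x \<le> C * N x" if x: "x \<in> V" for x
  proof (cases "x = 0")
    case True
    then show ?thesis using norm_on_zero[OF V] norm_on_zero[OF W] by simp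
  next
    case False
    with x have pos: "N x > 0"
      using norm_on_nonneg[OF V x] norm_on_eq_0[OF V x] by linarith
    have "(1 / N x) *\<^sub>R x \<in> ?U" "0 \<in> ?U"
      using norm_on_subspace[OF V] pos x
      by (auto simp: subspace_scale subspace_0 norm_on_scaleR[OF V] norm_on_zero[OF V])
    with C have "norm_dist W M ((1 / N x) *\<^sub>R x) 0 \<le> C"
      by blast
    moreover have "x \<in> W" using x \<open>V \<subseteq> W\<close> by blast
    ultimately have "\<bar>1 / N x\<bar> * M x \<le> C"
      using norm_on_subspace[OF W]
      by (simp add: norm_dist_def subspace_scale subspace_0 norm_on_scaleR[OF W])
    with pos show ?thesis by (simp add: field_simps)
  qed
  with that show ?thesis by blast
qed

text \<open>Scaling moves the bounded sequence into the unit ball, where compactness yields a limit;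
  scaling back gives \<open>l\<close>. This limit is only known to lie in the larger space
  \<open>W\<close>.\<close>

lemma compact_inclusion_convergent_subseq:
  fixes \<sigma> :: "nat \<Rightarrow> 'a::real_vector"
  assumes V: "norm_on V N" and W: "norm_on W M" and VW: "compact_inclusion V N W M"
    and \<sigma>: "\<And>k. \<sigma> k \<in> V" "\<And>k. N (\<sigma> k) \<le> B"
  obtains l r where "l \<in> W" "strict_mono (r :: nat \<Rightarrow> nat)" "(\<lambda>k. M (\<sigma> (r k) - l)) \<longlonglongrightarrow> 0"
proof -
  interpret W: Metric_space W "norm_dist W M" by (rule Metric_space_norm_dist[OF W])
  let ?U = "{x \<in> V. N x \<le> 1}"
  \<comment> \<open>Adding 1 makes \<open>b\<close> strictly positive, so that division by it is
    safe, also when \<open>B\<close> is 0.\<close>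
  define b where "b = \<bar>B\<bar> + 1"
  have b: "b > 0" and Bb: "B \<le> b" by (auto simp: b_def)
  have "V \<subseteq> W" and co: "compactin W.mtopology (W.mtopology closure_of ?U)"
    using VW by (auto simp: compact_inclusion_def norm_topology_def)
  have "(1 / b) *\<^sub>R \<sigma> k \<in> ?U" for k
    using \<sigma>[of k] b Bb norm_on_subspace[OF V]
    by (auto simp: norm_on_scaleR[OF V] subspace_scale field_simps)
  moreover have "?U \<subseteq> W.mtopology closure_of ?U"
    using \<open>V \<subseteq> W\<close> by (intro closure_of_subset) auto
  ultimately have "range (\<lambda>k. (1 / b) *\<^sub>R \<sigma> k) \<subseteq> W.mtopology closure_of ?U"
    by auto
  with co obtain m r where r: "strict_mono r"
    and lim: "limitin W.mtopology ((\<lambda>k. (1 / b) *\<^sub>R \<sigma> k) \<circ> r) m sequentially"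
    unfolding W.compactin_sequentially by blast
  from lim have m: "m \<in> W" and tend: "(\<lambda>k. M ((1 / b) *\<^sub>R \<sigma> (r k) - m)) \<longlonglongrightarrow> 0"
    by (auto simp: limitin_norm_topology[OF W, unfolded norm_topology_def])
  have "M (\<sigma> (r k) - b *\<^sub>R m) = b * M ((1 / b) *\<^sub>R \<sigma> (r k) - m)" for k
  proof -
    have "(1 / b) *\<^sub>R \<sigma> (r k) - m \<in> W"
      using \<sigma>(1) m \<open>V \<subseteq> W\<close> norm_on_subspace[OF W]
      by (intro subspace_diff subspace_scale) auto
    from norm_on_scaleR[OF W this, of b] show ?thesis
      using b by (simp add: scaleR_right_diff_distrib)
  qed
  then have "(\<lambda>k. M (\<sigma> (r k) - b *\<^sub>R m)) \<longlonglongrightarrow> 0"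
    using tendsto_mult_right_zero[OF tend, of b] by simp
  moreover have "b *\<^sub>R m \<in> W" using m norm_on_subspace[OF W] by (rule subspace_scale[rotated])
  ultimately show ?thesis using r that by blast
qed

section \<open>The graded metric\<close>

text \<open>The map \<open>t / (1 + t)\<close> is increasing on nonnegative reals. After
  \<open>p + q\<close> is split in the numerator, each denominator may be lowered to
  \<open>1 + p\<close> or \<open>1 + q\<close>.\<close>

lemma frac_one_plus_subadditive:
  fixes p q r :: real
  assumes "0 \<le> p" "0 \<le> q" "0 \<le> r" "r \<le> p + q"
  shows "r / (1 + r) \<le> p / (1 + p) + q / (1 + q)"
proof -
  have "r / (1 + r) \<le> (p + q) / (1 + (p + q))"
    using assms by (simp add: field_simps)
  also have "\<dots> = p / (1 + (p + q)) + q / (1 + (p + q))"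
    by (rule add_divide_distrib)
  also have "\<dots> \<le> p / (1 + p) + q / (1 + q)"
    using assms by (intro add_mono divide_left_mono mult_pos_pos) auto
  finally show ?thesis .
qed

locale compactly_graded_space =
  fixes X :: "nat \<Rightarrow> 'a::real_vector set" and N :: "nat \<Rightarrow> 'a \<Rightarrow> real"
  assumes compactly_graded: "compactly_graded X N"
begin

abbreviation "carrier \<equiv> graded_carrier X"
abbreviation "dist\<^sub>X \<equiv> graded_dist X N"

lemma norm: "norm_on (X n) (N n)"
  and incl: "compact_inclusion (X (Suc n)) (N (Suc n)) (X n) (N n)"
  using compactly_graded by (auto simp: compactly_graded_def banach_on_def)

lemma nested: "X (Suc n) \<subseteq> X n"
  using incl by (simp add: compact_inclusion_def)

lemma carrierD: "x \<in> carrier \<Longrightarrow> x \<in> X n"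
  by (auto simp: graded_carrier_def)

lemma subspace_carrier: "subspace carrier"
  unfolding graded_carrier_def using norm_on_subspace[OF norm] by (auto intro: subspace_Inter)

lemmas norm_nonneg = norm_on_nonneg[OF norm carrierD]
  and norm_scaleR = norm_on_scaleR[OF norm carrierD]
  and norm_triangle = norm_on_triangle[OF norm carrierD carrierD]

lemmas norm_zero = norm_on_zero[OF norm]

lemma term_le_dist: "(1/2) ^ n * norm_dist (X n) (N n) x y / (1 + norm_dist (X n) (N n) x y) \<le> dist\<^sub>X x y"
  using graded_dist_attained[OF compactly_graded, of x y] by metis

lemma dist_attained:
  obtains n where
    "dist\<^sub>X x y = (1/2) ^ n * norm_dist (X n) (N n) x y / (1 + norm_dist (X n) (N n) x y)"
  using graded_dist_attained[OF compactly_graded, of x y] by metis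

lemma Metric_space_graded_dist: "Metric_space carrier dist\<^sub>X"
proof
  fix x y z assume xyz: "x \<in> carrier" "y \<in> carrier" "z \<in> carrier"
  \<comment> \<open>At an index where the maximum for \<open>x\<close> and \<open>z\<close> is
    attained, the triangle inequality concerns a single term. The other two distances dominate their
    own terms at this index.\<close>
  obtain n where n: "dist\<^sub>X x z = (1/2) ^ n * norm_dist (X n) (N n) x z / (1 + norm_dist (X n) (N n) x z)"
    by (rule dist_attained)
  interpret Metric_space "X n" "norm_dist (X n) (N n)" by (rule Metric_space_norm_dist[OF norm])
  let ?d = "norm_dist (X n) (N n)"
  have tri: "?d x z \<le> ?d x y + ?d y z" using xyz by (intro triangle carrierD)
  have "?d x z / (1 + ?d x z) \<le> ?d x y / (1 + ?d x y) + ?d y z / (1 + ?d y z)"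
    by (rule frac_one_plus_subadditive) (use tri nonneg in auto)
  then have "(1/2) ^ n * (?d x z / (1 + ?d x z)) \<le>
      (1/2) ^ n * (?d x y / (1 + ?d x y) + ?d y z / (1 + ?d y z))"
    by (rule mult_left_mono) simp
  also have "\<dots> \<le> dist\<^sub>X x y + dist\<^sub>X y z"
    using term_le_dist[of n x y] term_le_dist[of n y z] by (simp add: algebra_simps)
  finally show "dist\<^sub>X x z \<le> dist\<^sub>X x y + dist\<^sub>X y z" by (simp add: n)
next
  fix x y
  show "0 \<le> dist\<^sub>X x y"
    using norm_dist_nonneg[OF norm] by (rule_tac x=x and y=y in dist_attained) simp
  show "dist\<^sub>X x y = dist\<^sub>X y x"
    unfolding graded_dist_def using norm_dist_commute[OF norm] by metis
next
  fix x y assume xy: "x \<in> carrier" "y \<in> carrier"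
  show "dist\<^sub>X x y = 0 \<longleftrightarrow> x = y"
  proof
    interpret Metric_space "X 0" "norm_dist (X 0) (N 0)" by (rule Metric_space_norm_dist[OF norm])
    assume "dist\<^sub>X x y = 0"
    \<comment> \<open>The term of index 0 has weight 1 and already separates points.\<close>
    then have "norm_dist (X 0) (N 0) x y / (1 + norm_dist (X 0) (N 0) x y) \<le> 0"
      using term_le_dist[of 0 x y] by simp
    then have "norm_dist (X 0) (N 0) x y = 0"
      using nonneg[of x y] by (simp add: divide_le_0_iff)
    then show "x = y" using xy carrierD by simp
  next
    assume "x = y"
    then show "dist\<^sub>X x y = 0"
      using xy norm_zero by (simp add: graded_dist_on_carrier)
  qed
qed

sublocale Metric_space carrier dist\<^sub>X
  by (rule Metric_space_graded_dist)

lemma graded_topology: "graded_topology X N = mtopology"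
  by (simp add: graded_topology_def)

text \<open>On the carrier the distance depends only on the difference of the points. This allows
  increments of \<open>f\<close> to be compared after a shift by \<open>f x\<close>.\<close>

lemma dist_translate:
  assumes "x \<in> carrier" "y \<in> carrier" "z \<in> carrier"
  shows "dist\<^sub>X (x + z) (y + z) = dist\<^sub>X x y"
  using assms by (simp add: graded_dist_on_carrier subspace_add[OF subspace_carrier])

text \<open>The terms with index at least \<open>L\<close> are at most \<open>(1/2) ^ L < e\<close>,
  whatever the points are. The finitely many others are controlled by the norms, since
  \<open>w / (1 + w) \<le> w\<close>.\<close>

lemma dist_tendsto_0:
  fixes \<sigma> :: "nat \<Rightarrow> 'a"
  assumes \<sigma>: "\<And>k. \<sigma> k \<in> carrier" and l: "l \<in> carrier"
    and lim: "\<And>n. (\<lambda>k. N n (\<sigma> k - l)) \<longlonglongrightarrow> 0"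
  shows "(\<lambda>k. dist\<^sub>X (\<sigma> k) l) \<longlonglongrightarrow> 0"
proof (rule LIMSEQ_I)
  fix e :: real assume e: "e > 0"
  obtain L where L: "(1/2::real) ^ L < e"
    using real_arch_pow_inv[OF e, of "1/2"] by auto
  have "\<forall>\<^sub>F k in sequentially. \<forall>n\<in>{..<L}. N n (\<sigma> k - l) < e"
    using order_tendstoD(2)[OF lim e] by (intro eventually_ball_finite) auto
  then obtain K where K: "\<And>k n. k \<ge> K \<Longrightarrow> n < L \<Longrightarrow> N n (\<sigma> k - l) < e"
    unfolding eventually_sequentially by (meson lessThan_iff)
  have "dist\<^sub>X (\<sigma> k) l < e" if "k \<ge> K" for k
  proof -
    obtain n where "dist\<^sub>X (\<sigma> k) l =
        (1/2) ^ n * norm_dist (X n) (N n) (\<sigma> k) l / (1 + norm_dist (X n) (N n) (\<sigma> k) l)"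
      by (rule dist_attained)
    moreover define w where "w = N n (\<sigma> k - l)"
    ultimately have d: "dist\<^sub>X (\<sigma> k) l = (1/2) ^ n * (w / (1 + w))"
      using \<sigma> l by (simp add: norm_dist_def carrierD)
    have w: "w \<ge> 0"
      unfolding w_def using \<sigma> l by (intro norm_nonneg subspace_diff[OF subspace_carrier])
    show ?thesis
    proof (cases "n < L")
      case True
      have "(1/2) ^ n * (w / (1 + w)) \<le> 1 * w"
        using w by (intro mult_mono) (auto simp: power_le_one divide_simps algebra_simps)
      with K[OF that True] d show ?thesis by (simp add: w_def)
    next
      case False
      have "(1/2) ^ n * (w / (1 + w)) \<le> (1/2) ^ L * 1"
        using w False by (intro mult_mono power_decreasing) (auto simp: divide_simps)
      with L d show ?thesis by simp
    qed
  qed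
  then show "\<exists>K. \<forall>k\<ge>K. norm (dist\<^sub>X (\<sigma> k) l - 0) < e"
    using nonneg by auto
qed

section \<open>Compactness of order bounded sets\<close>

text \<open>The bound in the norm of index \<open>Suc n\<close> makes subsequences converge in
  \<open>X n\<close>. A diagonal subsequence converges at every level, and the limits at different
  levels coincide.\<close>

lemma bounded_convergent_subseq:
  fixes \<sigma> :: "nat \<Rightarrow> 'a"
  assumes \<sigma>: "\<And>k. \<sigma> k \<in> carrier" and bd: "\<And>n k. N n (\<sigma> k) \<le> B n"
  obtains l r where "l \<in> carrier" "strict_mono (r :: nat \<Rightarrow> nat)"
    "\<And>n. (\<lambda>k. N n (\<sigma> (r k) - l)) \<longlonglongrightarrow> 0"
proof -
  \<comment> \<open>The limit \<open>l\<close> may still depend on the level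
    \<open>n\<close>.\<close>
  define P where "P = (\<lambda>n s. \<exists>l\<in>X n. (\<lambda>k. N n (\<sigma> (s k) - l)) \<longlonglongrightarrow> 0)"
  interpret S: subseqs P
  proof
    fix n and s :: "nat \<Rightarrow> nat" assume "strict_mono s"
    obtain l r where "l \<in> X n" "strict_mono (r :: nat \<Rightarrow> nat)" "(\<lambda>k. N n (\<sigma> (s (r k)) - l)) \<longlonglongrightarrow> 0"
      using compact_inclusion_convergent_subseq[OF norm norm incl, of "\<lambda>k. \<sigma> (s k)" n "B (Suc n)"]
        carrierD[OF \<sigma>] bd by metis
    then show "\<exists>r'. strict_mono r' \<and> P n (s \<circ> r')" by (auto simp: P_def)
  qed
  define r where "r = S.diagseq"
  have "P n r" for n
  proof -
    \<comment> \<open>Without its first \<open>Suc n\<close> terms the diagonal sequence is a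
      subsequence of one satisfying \<open>P n\<close>. The dropped terms do not affect
      convergence.\<close>
    have "P n (r \<circ> (+) (Suc n))"
      unfolding r_def
    proof (rule S.diagseq_holds)
      fix t s :: "nat \<Rightarrow> nat" and m assume t: "strict_mono t" and "P m s"
      then obtain l where "l \<in> X m" and lim: "(\<lambda>k. N m (\<sigma> (s k) - l)) \<longlonglongrightarrow> 0"
        by (auto simp: P_def)
      with LIMSEQ_subseq_LIMSEQ[OF lim t] show "P m (s \<circ> t)"
        by (auto simp: P_def o_def)
    qed
    then obtain l where l: "l \<in> X n" and lim: "(\<lambda>k. N n (\<sigma> (r (k + Suc n)) - l)) \<longlonglongrightarrow> 0"
      by (auto simp: P_def o_def add.commute)
    from LIMSEQ_offset[OF lim] l show ?thesis by (auto simp: P_def)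
  qed
  then obtain l where l: "\<And>n. l n \<in> X n" and lim: "\<And>n. (\<lambda>k. N n (\<sigma> (r k) - l n)) \<longlonglongrightarrow> 0"
    unfolding P_def by metis
  \<comment> \<open>The inclusion of \<open>X (Suc n)\<close> in \<open>X n\<close> is bounded, so
    \<open>l (Suc n)\<close> is also a limit in \<open>X n\<close>, where limits are unique.\<close>
  have "l (Suc n) = l n" for n
  proof -
    interpret M: Metric_space "X n" "norm_dist (X n) (N n)" by (rule Metric_space_norm_dist[OF norm])
    obtain C where C: "\<And>x. x \<in> X (Suc n) \<Longrightarrow> N n x \<le> C * N (Suc n) x"
      using compact_inclusion_bounded[OF norm norm incl] by metis
    have "(\<lambda>k. N n (\<sigma> (r k) - l (Suc n))) \<longlonglongrightarrow> 0"
    proof (rule tendsto_sandwich)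
      have in_Suc: "\<sigma> (r k) - l (Suc n) \<in> X (Suc n)" for k
        using carrierD[OF \<sigma>] l norm_on_subspace[OF norm] by (intro subspace_diff) auto
      show "\<forall>\<^sub>F k in sequentially. 0 \<le> N n (\<sigma> (r k) - l (Suc n))"
        using in_Suc nested by (intro always_eventually allI norm_on_nonneg[OF norm]) blast
      show "\<forall>\<^sub>F k in sequentially. N n (\<sigma> (r k) - l (Suc n)) \<le> C * N (Suc n) (\<sigma> (r k) - l (Suc n))"
        using C in_Suc by simp
      show "(\<lambda>k. C * N (Suc n) (\<sigma> (r k) - l (Suc n))) \<longlonglongrightarrow> 0"
        using tendsto_mult_right_zero[OF lim[of "Suc n"]] .
    qed simp
    then have "limitin (norm_topology (X n) (N n)) (\<lambda>k. \<sigma> (r k)) (l (Suc n)) sequentially"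
      using l nested carrierD[OF \<sigma>] by (auto simp: limitin_norm_topology[OF norm])
    moreover have "limitin (norm_topology (X n) (N n)) (\<lambda>k. \<sigma> (r k)) (l n) sequentially"
      using l lim carrierD[OF \<sigma>] by (auto simp: limitin_norm_topology[OF norm])
    ultimately show ?thesis
      unfolding norm_topology_def by (rule M.limitin_metric_unique) simp
  qed
  then have const: "l n = l 0" for n by (induction n) simp_all
  show ?thesis
  proof (rule that)
    show "l 0 \<in> carrier" unfolding graded_carrier_def using l const by (metis INT_I)
    show "strict_mono r" unfolding r_def by (rule S.subseq_diagseq)
    show "(\<lambda>k. N n (\<sigma> (r k) - l 0)) \<longlonglongrightarrow> 0" for n
      using lim[of n] unfolding const[of n] .
  qed
qed

text \<open>A convergent \<open>s\<close> is bounded, so the sequence is bounded in every norm and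
  has a convergent subsequence. The varying factor \<open>s k\<close> serves the passage to a
  supremum; a constant \<open>s\<close> covers a fixed order interval.\<close>

lemma order_interval_subseq:
  fixes \<sigma> :: "nat \<Rightarrow> 'a"
  assumes \<sigma>: "\<And>k. \<sigma> k \<in> carrier" and bd: "\<And>n k. N n (\<sigma> k) \<le> s k * a n"
    and s: "s \<longlonglongrightarrow> s0" and a: "\<And>n. 0 \<le> a n"
  obtains l r where "l \<in> carrier" "strict_mono (r :: nat \<Rightarrow> nat)" "\<And>n. N n l \<le> s0 * a n"
    "limitin (graded_topology X N) (\<sigma> \<circ> r) l sequentially"
proof -
  obtain K where "\<And>k. s k \<le> K"
    using convergent_imp_Bseq[OF convergentI[OF s]] unfolding Bseq_def
    by (metis abs_le_D1 real_norm_def)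
  then have "N n (\<sigma> k) \<le> K * a n" for n k
    using bd[of n k] mult_right_mono[OF _ a] by (meson order_trans)
  then obtain l r where l: "l \<in> carrier" and r: "strict_mono (r :: nat \<Rightarrow> nat)"
    and lim: "\<And>n. (\<lambda>k. N n (\<sigma> (r k) - l)) \<longlonglongrightarrow> 0"
    using bounded_convergent_subseq[of \<sigma> "\<lambda>n. K * a n"] \<sigma> by metis
  show ?thesis
  proof (rule that[OF l r])
    show "N n l \<le> s0 * a n" for n
    proof (rule LIMSEQ_le_const)
      show "(\<lambda>k. s (r k) * a n + N n (\<sigma> (r k) - l)) \<longlonglongrightarrow> s0 * a n"
        using tendsto_add[OF tendsto_mult_right[OF LIMSEQ_subseq_LIMSEQ[OF s r]] lim[of n]]
        by (simp add: o_def)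
      have "N n l \<le> s (r k) * a n + N n (\<sigma> (r k) - l)" for k
      proof -
        have diff: "\<sigma> (r k) - l \<in> carrier"
          using \<sigma> l by (intro subspace_diff[OF subspace_carrier])
        \<comment> \<open>The triangle inequality is applied to \<open>l\<close> written as
          \<open>\<sigma> (r k)\<close> plus the negative of
          \<open>\<sigma> (r k) - l\<close>.\<close>
        then have "(-1) *\<^sub>R (\<sigma> (r k) - l) \<in> carrier"
          by (rule subspace_scale[OF subspace_carrier])
        from norm_triangle[OF \<sigma> this, of n "r k"]
        have "N n l \<le> N n (\<sigma> (r k)) + N n (\<sigma> (r k) - l)"
          by (simp only: norm_scaleR[OF diff]) simp
        with bd[of n "r k"] show ?thesis by simp
      qed
      then show "\<exists>K. \<forall>k\<ge>K. N n l \<le> s (r k) * a n + N n (\<sigma> (r k) - l)" by blast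
    qed
    have "(\<lambda>k. dist\<^sub>X ((\<sigma> \<circ> r) k) l) \<longlonglongrightarrow> 0"
      using dist_tendsto_0[OF _ l, of "\<sigma> \<circ> r"] \<sigma> lim by simp
    then show "limitin (graded_topology X N) (\<sigma> \<circ> r) l sequentially"
      unfolding graded_topology limitin_metric_dist_null using l \<sigma> by simp
  qed
qed

end

section \<open>Approximate solutions by continuation\<close>

text \<open>Here \<open>a n\<close> stands for \<open>c * NY (n + d) y\<close>. Every step solves
  the linearised equation for the same \<open>y\<close>, so one family of bounds serves at all
  points.\<close>

lemma graded_approximate_solution:
  fixes X :: "nat \<Rightarrow> 'a::real_vector set" and Y :: "nat \<Rightarrow> 'b::real_vector set"
  assumes "compactly_graded X NX" and "compactly_graded Y NY"
    and cont: "continuous_map (graded_topology X NX) (graded_topology Y NY) f"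
    and deriv: "\<And>x. x \<in> graded_carrier X \<Longrightarrow> has_strong_gateaux_derivative X NX Y NY f (f' x) x"
    and f0: "f 0 = 0" and y: "y \<in> graded_carrier Y" and a: "\<And>n. 0 \<le> a n"
    and solve: "\<And>x. x \<in> graded_carrier X \<Longrightarrow>
      \<exists>u\<in>graded_carrier X. f' x u = y \<and> (\<forall>n. NX n u \<le> a n)"
    and \<epsilon>: "\<epsilon> > 0"
  shows "\<exists>x\<in>graded_carrier X. (\<forall>n. NX n x \<le> a n) \<and> graded_dist Y NY (f x) y \<le> \<epsilon>"
proof -
  interpret X: compactly_graded_space X NX by unfold_locales fact
  interpret Y: compactly_graded_space Y NY by unfold_locales fact
  note sX = X.subspace_carrier and sY = Y.subspace_carrier
  have fY: "f x \<in> Y.carrier" if "x \<in> X.carrier" for x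
    using continuous_map_funspace[OF cont] that unfolding X.graded_topology Y.graded_topology
    by auto
  \<comment> \<open>The tolerance is proportional to \<open>s\<close>: a step of length
    \<open>t\<close> with error at most \<open>\<epsilon> * t\<close> then keeps the estimate, and
    \<open>0\<close> is admissible at \<open>s = 0\<close>.\<close>
  define Q where "Q s x \<longleftrightarrow> x \<in> X.carrier \<and> (\<forall>n. NX n x \<le> s * a n) \<and>
    graded_dist Y NY (f x) (s *\<^sub>R y) \<le> \<epsilon> * s" for s x
  define S where "S = {s \<in> {0..1}. \<exists>x. Q s x}"
  have "Q 0 0"
    using f0 sX sY X.norm_zero by (simp add: Q_def subspace_0)
  then have S0: "0 \<in> S" by (auto simp: S_def)
  have bdd: "bdd_above S" by (rule bdd_aboveI[of _ 1]) (auto simp: S_def)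
  define s0 where "s0 = Sup S"
  have "s0 \<in> closure S"
    unfolding s0_def using S0 bdd by (intro closure_contains_Sup) auto
  then obtain s where sS: "\<And>k. s k \<in> S" and s: "s \<longlonglongrightarrow> s0"
    unfolding closure_sequential by blast
  have s0: "0 \<le> s0" "s0 \<le> 1"
    unfolding s0_def
  proof -
    show "0 \<le> Sup S" by (rule cSup_upper[OF S0 bdd])
    show "Sup S \<le> 1" by (rule cSup_least) (use S0 in blast, simp add: S_def)
  qed
  from sS have "\<forall>k. \<exists>x. Q (s k) x" unfolding S_def by blast
  then obtain \<sigma> where Q: "\<And>k. Q (s k) (\<sigma> k)" by metis
  then have \<sigma>: "\<And>k. \<sigma> k \<in> X.carrier" and bd: "\<And>n k. NX n (\<sigma> k) \<le> s k * a n"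
    by (auto simp: Q_def)
  obtain x r where x: "x \<in> X.carrier" and r: "strict_mono r" and xb: "\<And>n. NX n x \<le> s0 * a n"
    and lim: "limitin (graded_topology X NX) (\<sigma> \<circ> r) x sequentially"
    using X.order_interval_subseq[of \<sigma> s a s0, OF \<sigma> bd s a] by blast
  have flim: "(\<lambda>k. graded_dist Y NY (f (\<sigma> (r k))) (f x)) \<longlonglongrightarrow> 0"
    using continuous_map_limit[OF cont lim]
    unfolding Y.graded_topology Y.limitin_metric_dist_null by (simp add: o_def)
  have sr: "(\<lambda>k. s (r k)) \<longlonglongrightarrow> s0"
    using LIMSEQ_subseq_LIMSEQ[OF s r] by (simp add: o_def)
  \<comment> \<open>The graded distance is not homogeneous, so convergence is checked in each norm
    separately.\<close>
  have ylim: "(\<lambda>k. graded_dist Y NY (s (r k) *\<^sub>R y) (s0 *\<^sub>R y)) \<longlonglongrightarrow> 0"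
  proof (rule Y.dist_tendsto_0)
    show "(\<lambda>k. NY n (s (r k) *\<^sub>R y - s0 *\<^sub>R y)) \<longlonglongrightarrow> 0" for n
    proof -
      have "(\<lambda>k. \<bar>s (r k) - s0\<bar> * NY n y) \<longlonglongrightarrow> 0"
        using sr by (intro tendsto_mult_left_zero tendsto_rabs_zero) (simp add: LIM_zero)
      then show ?thesis
        using Y.norm_scaleR[OF y] by (simp flip: scaleR_left_diff_distrib)
    qed
  qed (use y sY in \<open>auto intro: subspace_scale\<close>)
  \<comment> \<open>The detour through \<open>f (\<sigma> (r k))\<close> and
    \<open>s (r k) *\<^sub>R y\<close> has outer distances tending to 0 and a middle one of at most
    \<open>\<epsilon> * s (r k)\<close>.\<close>
  have "graded_dist Y NY (f x) (s0 *\<^sub>R y) \<le> \<epsilon> * s0"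
  proof (rule LIMSEQ_le_const)
    show "(\<lambda>k. graded_dist Y NY (f (\<sigma> (r k))) (f x) + \<epsilon> * s (r k)
        + graded_dist Y NY (s (r k) *\<^sub>R y) (s0 *\<^sub>R y)) \<longlonglongrightarrow> \<epsilon> * s0"
      using tendsto_add[OF tendsto_add[OF flim tendsto_mult_left[OF sr]] ylim] by simp
    have "graded_dist Y NY (f x) (s0 *\<^sub>R y) \<le> graded_dist Y NY (f (\<sigma> (r k))) (f x) + \<epsilon> * s (r k)
        + graded_dist Y NY (s (r k) *\<^sub>R y) (s0 *\<^sub>R y)" for k
    proof -
      have mem: "f x \<in> Y.carrier" "f (\<sigma> (r k)) \<in> Y.carrier" "s (r k) *\<^sub>R y \<in> Y.carrier"
        "s0 *\<^sub>R y \<in> Y.carrier"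
        using fY x \<sigma> y sY by (auto intro: subspace_scale)
      have "graded_dist Y NY (f (\<sigma> (r k))) (s (r k) *\<^sub>R y) \<le> \<epsilon> * s (r k)"
        using Q by (simp add: Q_def)
      with mem Y.triangle[of "f x" "f (\<sigma> (r k))" "s0 *\<^sub>R y"]
        Y.triangle[of "f (\<sigma> (r k))" "s (r k) *\<^sub>R y" "s0 *\<^sub>R y"]
        Y.commute[of "f x" "f (\<sigma> (r k))"]
      show ?thesis by linarith
    qed
    then show "\<exists>K. \<forall>k\<ge>K. graded_dist Y NY (f x) (s0 *\<^sub>R y) \<le>
        graded_dist Y NY (f (\<sigma> (r k))) (f x) + \<epsilon> * s (r k)
        + graded_dist Y NY (s (r k) *\<^sub>R y) (s0 *\<^sub>R y)" by blast
  qed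
  with x xb have Q0: "Q s0 x" by (simp add: Q_def)
  have "s0 = 1"
  proof (rule ccontr)
    assume "s0 \<noteq> 1"
    with s0 have "s0 < 1" by simp
    from solve[OF x] obtain u where u: "u \<in> X.carrier" "f' x u = y" "\<And>n. NX n u \<le> a n"
      by blast
    have "((\<lambda>t. graded_dist Y NY (f (x + t *\<^sub>R u) - f x) (t *\<^sub>R y) / t) \<longlongrightarrow> 0) (at_right 0)"
      using deriv[OF x] u unfolding has_strong_gateaux_derivative_def by auto
    then have "\<forall>\<^sub>F t in at_right 0. graded_dist Y NY (f (x + t *\<^sub>R u) - f x) (t *\<^sub>R y) / t < \<epsilon>"
      using \<epsilon> by (rule order_tendstoD(2))
    \<comment> \<open>The upper bound on \<open>t\<close> keeps \<open>s0 + t\<close> inside the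
      unit interval.\<close>
    moreover have "\<forall>\<^sub>F t in at_right 0. 0 < t \<and> t < 1 - s0"
      using \<open>s0 < 1\<close> eventually_at_right_real[of 0 "1 - s0"] by (simp add: eventually_mono)
    ultimately have "\<forall>\<^sub>F t in at_right 0.
        graded_dist Y NY (f (x + t *\<^sub>R u) - f x) (t *\<^sub>R y) / t < \<epsilon> \<and> 0 < t \<and> t < 1 - s0"
      by (rule eventually_conj)
    then obtain t where "graded_dist Y NY (f (x + t *\<^sub>R u) - f x) (t *\<^sub>R y) / t < \<epsilon>"
      and t: "0 < t" "t < 1 - s0"
      using eventually_happens'[OF trivial_limit_at_right_real] by blast
    then have small: "graded_dist Y NY (f (x + t *\<^sub>R u) - f x) (t *\<^sub>R y) \<le> \<epsilon> * t"
      by (simp add: field_simps)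
    let ?x = "x + t *\<^sub>R u"
    have x': "?x \<in> X.carrier" using x u sX by (intro subspace_add subspace_scale)
    have mem: "f ?x \<in> Y.carrier" "f x \<in> Y.carrier" "t *\<^sub>R y \<in> Y.carrier" "s0 *\<^sub>R y \<in> Y.carrier"
      "f ?x - f x \<in> Y.carrier" "t *\<^sub>R y + f x \<in> Y.carrier" "s0 *\<^sub>R y + t *\<^sub>R y \<in> Y.carrier"
      using fY[OF x] fY[OF x'] y sY by (auto intro: subspace_scale subspace_add subspace_diff)
    \<comment> \<open>With \<open>t *\<^sub>R y + f x\<close> as intermediate point, removing the
      shift \<open>f x\<close> leaves the error of differentiation, and removing the shift
      \<open>t *\<^sub>R y\<close> leaves the error already present at \<open>s0\<close>.\<close>
    have "graded_dist Y NY (f ?x) ((s0 + t) *\<^sub>R y)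
        \<le> graded_dist Y NY (f ?x) (t *\<^sub>R y + f x) + graded_dist Y NY (t *\<^sub>R y + f x) (s0 *\<^sub>R y + t *\<^sub>R y)"
      using Y.triangle[OF mem(1,6,7)] by (simp add: scaleR_left_distrib)
    also have "graded_dist Y NY (f ?x) (t *\<^sub>R y + f x) = graded_dist Y NY (f ?x - f x) (t *\<^sub>R y)"
      using Y.dist_translate[OF mem(5,3,2)] by simp
    also have "graded_dist Y NY (t *\<^sub>R y + f x) (s0 *\<^sub>R y + t *\<^sub>R y) = graded_dist Y NY (f x) (s0 *\<^sub>R y)"
      using Y.dist_translate[OF mem(2,4,3)] by (simp add: add.commute)
    finally have "graded_dist Y NY (f ?x) ((s0 + t) *\<^sub>R y) \<le> \<epsilon> * (s0 + t)"
      using small Q0 by (simp add: Q_def algebra_simps)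
    moreover have "NX n ?x \<le> (s0 + t) * a n" for n
    proof -
      have "NX n ?x \<le> NX n x + t * NX n u"
        using X.norm_triangle[OF x subspace_scale[OF sX u(1)], of n t] t
        by (simp add: X.norm_scaleR[OF u(1)])
      also have "\<dots> \<le> s0 * a n + t * a n"
        using xb u(3) t by (intro add_mono mult_left_mono) auto
      finally show ?thesis by (simp add: algebra_simps)
    qed
    ultimately have "s0 + t \<in> S" using x' s0 t by (auto simp: S_def Q_def)
    from cSup_upper[OF this bdd] t show False by (simp add: s0_def)
  qed
  with Q0 show ?thesis by (auto simp: Q_def)
qed

section \<open>Exact solutions as limits of approximate ones\<close>

theorem theorem8:
  fixes X :: "nat \<Rightarrow> 'a::real_vector set" and NX :: "nat \<Rightarrow> 'a \<Rightarrow> real"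
    and Y :: "nat \<Rightarrow> 'b::real_vector set" and NY :: "nat \<Rightarrow> 'b \<Rightarrow> real"
    and f :: "'a \<Rightarrow> 'b" and f' :: "'a \<Rightarrow> 'a \<Rightarrow> 'b"
    and c :: real and d :: nat
  assumes "compactly_graded X NX" and "compactly_graded Y NY"
    and "continuous_map (graded_topology X NX) (graded_topology Y NY) f"
    and "\<forall>x\<in>graded_carrier X. has_strong_gateaux_derivative X NX Y NY f (f' x) x"
    and "f 0 = 0"
    and "c > 0"
    and "\<forall>x\<in>graded_carrier X. \<forall>v\<in>graded_carrier Y. \<exists>u\<in>graded_carrier X.
           f' x u = v \<and> (\<forall>n. NX n u \<le> c * NY (n + d) v)"
  shows "\<forall>y\<in>graded_carrier Y. \<exists>x\<in>graded_carrier X.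
           f x = y \<and> (\<forall>n. NX n x \<le> c * NY (n + d) y)"
proof
  interpret X: compactly_graded_space X NX by unfold_locales fact
  interpret Y: compactly_graded_space Y NY by unfold_locales fact
  fix y assume y: "y \<in> Y.carrier"
  define a where "a n = c * NY (n + d) y" for n
  have a: "0 \<le> a n" for n using \<open>c > 0\<close> Y.norm_nonneg[OF y] by (simp add: a_def)
  have "\<exists>x\<in>X.carrier. (\<forall>n. NX n x \<le> a n) \<and> graded_dist Y NY (f x) y \<le> inverse (real (Suc k))" for k
    by (rule graded_approximate_solution[where f' = f']) (use assms y a in \<open>auto simp: a_def\<close>)
  \<comment> \<open>The factor 1 gives the bound the form required by
    \<open>order_interval_subseq\<close> for the constant sequence 1.\<close>
  then obtain \<sigma> where \<sigma>: "\<And>k. \<sigma> k \<in> X.carrier" "\<And>n k. NX n (\<sigma> k) \<le> 1 * a n"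
    and near: "\<And>k. graded_dist Y NY (f (\<sigma> k)) y \<le> inverse (real (Suc k))"
    by simp metis
  obtain x r where x: "x \<in> X.carrier" and r: "strict_mono (r :: nat \<Rightarrow> nat)"
    and xb: "\<And>n. NX n x \<le> 1 * a n"
    and lim: "limitin (graded_topology X NX) (\<sigma> \<circ> r) x sequentially"
    using X.order_interval_subseq[of \<sigma> "\<lambda>_. 1" a 1, OF \<sigma> tendsto_const a] by blast
  note flim = continuous_map_limit[OF assms(3) lim]
  have "(\<lambda>k. graded_dist Y NY (f (\<sigma> k)) y) \<longlonglongrightarrow> 0"
    by (rule tendsto_sandwich[OF _ _ tendsto_const LIMSEQ_inverse_real_of_nat])
      (use near Y.nonneg in auto)
  from LIMSEQ_subseq_LIMSEQ[OF this r]
  have "limitin (graded_topology Y NY) (f \<circ> (\<sigma> \<circ> r)) y sequentially"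
    using flim y unfolding Y.graded_topology Y.limitin_metric_dist_null by (simp add: o_def)
  \<comment> \<open>Along the subsequence the values of \<open>f\<close> tend to \<open>f x\<close>
    by continuity and to \<open>y\<close> by the vanishing tolerance.\<close>
  with flim have "f x = y"
    unfolding Y.graded_topology by (rule Y.limitin_metric_unique) simp
  with x xb show "\<exists>x\<in>X.carrier. f x = y \<and> (\<forall>n. NX n x \<le> c * NY (n + d) y)"
    by (auto simp: a_def)
qed

end
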